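(* Let $D\subseteq\mathbb{R}^d$ be open, let $f:D\to\mathbb{R}^d$ be locally Lipschitz, let $x^*\in D$ be an equilibrium of $\dot x=f(x)$, and let $S\subseteq D$ be a compact set with $x^*\in\mathrm{int}(S)$. Let $V:D\to\mathbb{R}_{\ge0}$ be an Exponential Recurrent Lyapunov Function (ERLF) over $S$ with constants $a_1,a_2,\alpha,\tau>0$. Then $x^*$ is exponentially stable with rate $\alpha$ on the set $S$; that is, for every $x\in S$, $$\|\phi(t,x)-x^*\|\le C\,e^{-\alpha t}\,\|x-x^*\|,\qquad t\ge 0,$$ with $$C:=\frac{a_2}{a_1}\,e^{\alpha\tau}\bigl(1+\overline L\,h(\tau;L)\bigr),$$ where $L:=L_{\mathrm{cl}\,\mathcal{R}^\tau(S)}$ is the one-sided Lipschitz constant of $f$ over $\mathrm{cl}\,\mathcal{R}^\tau(S)$, $\overline L:=\overline L_{\mathrm{cl}\,\mathcal{R}^\tau(S)}$ is a Lipschitz constant of $f$ over $\mathrm{cl}\,\mathcal{R}^\tau(S)$, and $h(\tau;L)=(e^{L\tau}-1)/L$ if $L\ne0$, $h(\tau;0)=\tau$.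
   Context: $\|\cdot\|$ is a fixed norm on $\mathbb{R}^d$. Locally Lipschitz means: for every compact $K\subset D$ there is $\overline L_K\ge 0$ (a Lipschitz constant over $K$) with $\|f(y)-f(x)\|\le \overline L_K\|y-x\|$ for all $x,y\in K$. For $x\in D$, $\phi(t,x)$ is the solution of $\dot x=f(x)$ with $\phi(0,x)=x$, defined on its maximal open interval of existence $I(x)\ni 0$. An assertion about $\phi(t,x)$ for all $t\ge0$ includes that the solution exists for all $t\ge 0$. Weak pairing: the norm is equipped with an associated weak pairing $[\cdot;\cdot]:\mathbb{R}^d\times\mathbb{R}^d\to\mathbb{R}$, i.e. a map with (i) $[x_1+x_2;y]\le[x_1;y]+[x_2;y]$; (ii) $[\alpha x;y]=[x;\alpha y]=\alpha[x;y]$ for $\alpha>0$ and $[-x;-y]=[x;y]$; (iii) $[x;x]>0$ for $x\ne0$; (iv) $|[x;y]|\le[x;x]^{1/2}[y;y]^{1/2}$; such that $\|x\|=[x;x]^{1/2}$, and satisfying the curve norm derivative formula $\|x(t)\|\,D^+\|x(t)\|=[\dot x(t);x(t)]$ along differentiable curves, where $D^+\varphi(t)=\limsup_{h\to0^+}(\varphi(t+h)-\varphi(t))/h$. The one-sided Lipschitz constant of $f$ over a compact $K\subset D$ is the smallest $L_K\in\mathbb{R}$ with $[f(y)-f(x);y-x]\le L_K\|y-x\|^2$ for all $x,y\in K$. Reachable tube: $\mathcal{R}^\tau(S)=\{\phi(t,x): x\in S,\ t\in[0,\tau]\cap I(x)\}$. Containment times: $T_S(x;\tau):=\{t\in(0,\tau]: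 \phi(t,x)\in S\}$ (with $t\in I(x)$). An inequality $\min_{s\in T_S(x;\tau)}g(s)\le c$ means that there is $s\in T_S(x;\tau)$ with $g(s)\le c$; in particular $T_S(x;\tau)\neq\emptyset$. ERLF: a continuous $V:D\to\mathbb{R}_{\ge0}$ is an Exponential Recurrent Lyapunov Function over $S$ if there are constants $a_1,a_2,\alpha,\tau>0$ with (i) $a_1\|x-x^*\|\le V(x)\le a_2\|x-x^*\|$ for all $x\in D$; (ii) $\min_{s\in T_S(x;\tau)}e^{\alpha s}V(\phi(s,x))\le V(x)$ for all $x\in S\setminus\{x^*\}$. *)

theory Defs
  imports "HOL-Analysis.Analysis"
begin

text \<open>
  The norm on \<open>\<real>\<^sup>d\<close> is arbitrary, so it is an explicit function \<open>N\<close> on \<open>real ^ 'n\<close>.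
  Topological notions and derivatives are those of the type; all norms on \<open>\<real>\<^sup>d\<close> induce the same ones.
\<close>

definition is_norm :: "(real ^ 'n \<Rightarrow> real) \<Rightarrow> bool" where
  "is_norm N \<longleftrightarrow>
     (\<forall>x. 0 \<le> N x) \<and>
     (\<forall>x. N x = 0 \<longleftrightarrow> x = 0) \<and>
     (\<forall>c x. N (c *\<^sub>R x) = \<bar>c\<bar> * N x) \<and>
     (\<forall>x y. N (x + y) \<le> N x + N y)"

definition upper_right_dini :: "(real \<Rightarrow> real) \<Rightarrow> real \<Rightarrow> ereal" where
  "upper_right_dini g t = Limsup (at_right 0) (\<lambda>h. ereal ((g (t + h) - g t) / h))"

definition weak_pairing :: "(real ^ 'n \<Rightarrow> real ^ 'n \<Rightarrow> real) \<Rightarrow> bool" where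
  "weak_pairing wp \<longleftrightarrow>
     (\<forall>x1 x2 y. wp (x1 + x2) y \<le> wp x1 y + wp x2 y) \<and>
     (\<forall>a x y. 0 < a \<longrightarrow> wp (a *\<^sub>R x) y = a * wp x y \<and> wp x (a *\<^sub>R y) = a * wp x y) \<and>
     (\<forall>x y. wp (- x) (- y) = wp x y) \<and>
     (\<forall>x. x \<noteq> 0 \<longrightarrow> 0 < wp x x) \<and>
     (\<forall>x y. \<bar>wp x y\<bar> \<le> sqrt (wp x x) * sqrt (wp y y))"

definition curve_norm_derivative_formula ::
    "(real ^ 'n \<Rightarrow> real) \<Rightarrow> (real ^ 'n \<Rightarrow> real ^ 'n \<Rightarrow> real) \<Rightarrow> bool" where
  "curve_norm_derivative_formula N wp \<longleftrightarrow>
     (\<forall>x x' a b. (\<forall>t\<in>{a<..<b}. (x has_vector_derivative x' t) (at t)) \<longrightarrow>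
        (\<forall>t\<in>{a<..<b}. ereal (N (x t)) * upper_right_dini (\<lambda>s. N (x s)) t = ereal (wp (x' t) (x t))))"

definition associated_weak_pairing ::
    "(real ^ 'n \<Rightarrow> real) \<Rightarrow> (real ^ 'n \<Rightarrow> real ^ 'n \<Rightarrow> real) \<Rightarrow> bool" where
  "associated_weak_pairing N wp \<longleftrightarrow>
     weak_pairing wp \<and> (\<forall>x. N x = sqrt (wp x x)) \<and> curve_norm_derivative_formula N wp"

definition lipschitz_const_over ::
    "(real ^ 'n \<Rightarrow> real) \<Rightarrow> (real ^ 'n \<Rightarrow> real ^ 'n) \<Rightarrow> (real ^ 'n) set \<Rightarrow> real \<Rightarrow> bool" where
  "lipschitz_const_over N f K M \<longleftrightarrow> 0 \<le> M \<and> (\<forall>x\<in>K. \<forall>y\<in>K. N (f y - f x) \<le> M * N (y - x))"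

definition locally_lipschitz ::
    "(real ^ 'n \<Rightarrow> real) \<Rightarrow> (real ^ 'n) set \<Rightarrow> (real ^ 'n \<Rightarrow> real ^ 'n) \<Rightarrow> bool" where
  "locally_lipschitz N D f \<longleftrightarrow> (\<forall>K. compact K \<and> K \<subseteq> D \<longrightarrow> (\<exists>M. lipschitz_const_over N f K M))"

definition one_sided_lipschitz_const ::
    "(real ^ 'n \<Rightarrow> real) \<Rightarrow> (real ^ 'n \<Rightarrow> real ^ 'n \<Rightarrow> real) \<Rightarrow>
     (real ^ 'n \<Rightarrow> real ^ 'n) \<Rightarrow> (real ^ 'n) set \<Rightarrow> real" where
  "one_sided_lipschitz_const N wp f K =
     (LEAST L. \<forall>x\<in>K. \<forall>y\<in>K. wp (f y - f x) (y - x) \<le> L * (N (y - x))\<^sup>2)"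

definition solves_ivp ::
    "(real ^ 'n \<Rightarrow> real ^ 'n) \<Rightarrow> (real ^ 'n) set \<Rightarrow> real ^ 'n \<Rightarrow> real set \<Rightarrow> (real \<Rightarrow> real ^ 'n) \<Rightarrow> bool" where
  "solves_ivp f D x J u \<longleftrightarrow>
     open J \<and> is_interval J \<and> 0 \<in> J \<and> u 0 = x \<and>
     (\<forall>t\<in>J. u t \<in> D \<and> (u has_vector_derivative f (u t)) (at t))"

text \<open>
  For locally Lipschitz \<open>f\<close> any two solutions agree on the intersection of their intervals, so the
  maximal interval of existence is the union of all solution intervals, and the value in \<open>flow\<close> is
  unique at every time in it.
\<close>

definition existence_ivl ::
    "(real ^ 'n \<Rightarrow> real ^ 'n) \<Rightarrow> (real ^ 'n) set \<Rightarrow> real ^ 'n \<Rightarrow> real set" where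
  "existence_ivl f D x = \<Union> {J. \<exists>u. solves_ivp f D x J u}"

definition flow ::
    "(real ^ 'n \<Rightarrow> real ^ 'n) \<Rightarrow> (real ^ 'n) set \<Rightarrow> real \<Rightarrow> real ^ 'n \<Rightarrow> real ^ 'n" where
  "flow f D t x = (THE y. \<exists>J u. solves_ivp f D x J u \<and> t \<in> J \<and> y = u t)"

definition reachable_tube ::
    "(real ^ 'n \<Rightarrow> real ^ 'n) \<Rightarrow> (real ^ 'n) set \<Rightarrow> real \<Rightarrow> (real ^ 'n) set \<Rightarrow> (real ^ 'n) set" where
  "reachable_tube f D \<tau> S = {flow f D t x | t x. x \<in> S \<and> t \<in> {0..\<tau>} \<inter> existence_ivl f D x}"

definition containment_times ::
    "(real ^ 'n \<Rightarrow> real ^ 'n) \<Rightarrow> (real ^ 'n) set \<Rightarrow> (real ^ 'n) set \<Rightarrow> real ^ 'n \<Rightarrow> real \<Rightarrow> real set" where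
  "containment_times f D S x \<tau> = {t \<in> {0<..\<tau>} \<inter> existence_ivl f D x. flow f D t x \<in> S}"

definition ERLF ::
    "(real ^ 'n \<Rightarrow> real) \<Rightarrow> (real ^ 'n \<Rightarrow> real ^ 'n) \<Rightarrow> (real ^ 'n) set \<Rightarrow> real ^ 'n \<Rightarrow>
     (real ^ 'n) set \<Rightarrow> (real ^ 'n \<Rightarrow> real) \<Rightarrow> real \<Rightarrow> real \<Rightarrow> real \<Rightarrow> real \<Rightarrow> bool" where
  "ERLF N f D xs S V a1 a2 \<alpha> \<tau> \<longleftrightarrow>
     continuous_on D V \<and> (\<forall>x\<in>D. 0 \<le> V x) \<and>
     0 < a1 \<and> 0 < a2 \<and> 0 < \<alpha> \<and> 0 < \<tau> \<and>
     (\<forall>x\<in>D. a1 * N (x - xs) \<le> V x \<and> V x \<le> a2 * N (x - xs)) \<and>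
     (\<forall>x\<in>S - {xs}. \<exists>s\<in>containment_times f D S x \<tau>. exp (\<alpha> * s) * V (flow f D s x) \<le> V x)"

definition h_fun :: "real \<Rightarrow> real \<Rightarrow> real" where
  "h_fun \<tau> L = (if L = 0 then \<tau> else (exp (L * \<tau>) - 1) / L)"

end

theory Submission
  imports Defs
begin

text \<open>
  Fix \<open>x \<in> S\<close> and call \<open>m \<ge> 0\<close> a decay time of \<open>x\<close> if \<open>\<phi>(m,x) \<in> S\<close> and
  \<open>e\<^bsup>\<alpha>m\<^esup> V(\<phi>(m,x)) \<le> V(x)\<close>. By the recurrence condition every decay time is followed by another
  one at distance at most \<open>\<tau>\<close>, but the steps may shrink. Since solutions starting in the compact
  set \<open>S\<close> exist for a uniform time, a limit of decay times lies in the interval of existence and is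
  again a decay time. Hence decay times cannot accumulate at a finite supremum, solutions exist for
  all \<open>t \<ge> 0\<close>, every \<open>t\<close> has a decay time in \<open>[t - \<tau>, t]\<close>, and the reachable tube is compact by
  continuous dependence on initial values. Between decay times, the curve norm derivative formula
  gives \<open>\<parallel>\<phi>(r,y) - x\<^sup>*\<parallel> \<le> e\<^bsup>Lr\<^esup> \<parallel>y - x\<^sup>*\<parallel>\<close>, and \<open>e\<^bsup>Lr\<^esup> = 1 + L h(r;L) \<le> 1 + Lbar h(\<tau>;L)\<close>
  because \<open>L \<le> Lbar\<close> by the Cauchy-Schwarz property of the weak pairing.
\<close>

subsection \<open>Gronwall estimates for Dini derivatives\<close>

lemma eventually_le_if_upper_right_dini_less:
  assumes "(y has_real_derivative y') (at t)" and "g t = y t" and "upper_right_dini g t < ereal y'"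
  shows "\<forall>\<^sub>F s in at_right t. g s \<le> y s"
proof -
  obtain q where q: "upper_right_dini g t < ereal q" "q < y'"
    using ereal_dense2[OF assms(3)] by auto
  have "\<forall>\<^sub>F h in at_right 0. (g (t + h) - g t) / h < q"
    using Limsup_lessD[OF q(1)[unfolded upper_right_dini_def]] by simp
  moreover have "((\<lambda>h. (y (t + h) - y t) / h) \<longlongrightarrow> y') (at_right 0)"
    using assms(1) unfolding DERIV_def by (rule tendsto_within_subset) simp
  then have "\<forall>\<^sub>F h in at_right 0. q < (y (t + h) - y t) / h"
    using q(2) by (rule order_tendstoD)
  moreover have "\<forall>\<^sub>F h in at_right (0::real). 0 < h"
    by (rule eventually_at_right_less)
  ultimately have "\<forall>\<^sub>F h in at_right 0. g (h + t) \<le> y (h + t)"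
  proof eventually_elim
    case (elim h)
    then have "(g (t + h) - g t) / h < (y (t + h) - y t) / h"
      by linarith
    then show ?case
      using elim(3) assms(2) by (simp add: divide_less_cancel add.commute)
  qed
  then show ?thesis
    unfolding eventually_at_right_to_0[of _ t] .
qed

lemma closed_contains_bound_if_right_extendable:
  fixes A :: "real set"
  assumes "closed A" "A \<noteq> {}" "A \<subseteq> {..b}" and extendable: "\<And>t. t \<in> A \<Longrightarrow> t < b \<Longrightarrow> \<exists>s\<in>A. t < s"
  shows "b \<in> A"
proof -
  have bdd: "bdd_above A" using assms(3) by (rule bdd_above_mono[OF bdd_above_Iic])
  have Sup: "Sup A \<in> A" by (rule closed_contains_Sup[OF assms(2) bdd assms(1)])
  have "\<not> Sup A < b"
    using extendable[OF Sup] cSup_upper[OF _ bdd] by (meson not_le)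
  then have "Sup A = b" using Sup assms(3) by fastforce
  then show ?thesis using Sup by simp
qed

lemma upper_right_dini_comparison:
  assumes "a \<le> b" and g: "continuous_on {a..b} g"
    and y: "\<And>t. t \<in> {a..b} \<Longrightarrow> (y has_real_derivative y' t) (at t)"
    and start: "g a \<le> y a"
    and crossing: "\<And>t. t \<in> {a..<b} \<Longrightarrow> g t = y t \<Longrightarrow> upper_right_dini g t < ereal (y' t)"
  shows "g b \<le> y b"
proof -
  have y_cont: "continuous_on {a..b} y"
    using y by (intro continuous_at_imp_continuous_on ballI) (rule DERIV_isCont)
  define below where "below = {t \<in> {a..b}. g t \<le> y t}"
  have "b \<in> below"
  proof (rule closed_contains_bound_if_right_extendable)
    show "closed below"
      unfolding below_def using g y_cont by (intro continuous_on_closed_Collect_le) simp_all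
    have "a \<in> below" using \<open>a \<le> b\<close> start by (simp add: below_def)
    then show "below \<noteq> {}" by blast
    show "below \<subseteq> {..b}" by (auto simp: below_def)
    fix t assume "t \<in> below" "t < b"
    then have t: "t \<in> {a..<b}" "g t \<le> y t" by (simp_all add: below_def)
    have "\<forall>\<^sub>F s in at_right t. g s \<le> y s"
    proof (cases "g t = y t")
      case True
      then show ?thesis
        using eventually_le_if_upper_right_dini_less[OF y] crossing t(1) by simp
    next
      case False
      have "((\<lambda>s. y s - g s) \<longlongrightarrow> y t - g t) (at_right t)"
        using continuous_on_subset[OF continuous_on_diff[OF y_cont g], of "{t..b}"] t(1)
        by (intro continuous_on_Icc_at_rightD[of t b]) auto
      then have "\<forall>\<^sub>F s in at_right t. 0 < y s - g s"
        by (rule order_tendstoD) (use t(2) False in simp)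
      then show ?thesis by eventually_elim simp
    qed
    moreover have "\<forall>\<^sub>F s in at_right t. s \<in> {t<..<b}"
      using t(1) by (intro eventually_at_right_real) simp
    ultimately have "\<forall>\<^sub>F s in at_right t. s \<in> below \<and> t < s"
      by eventually_elim (use t(1) in \<open>simp add: below_def\<close>)
    then show "\<exists>s\<in>below. t < s"
      using eventually_happens trivial_limit_at_right_real by blast
  qed
  then show ?thesis by (simp add: below_def)
qed

text \<open>
  Asking for the differential inequality only in a thin strip above the bound makes first-exit
  arguments unnecessary: a local Lipschitz condition near a compact trajectory is enough.
\<close>

lemma upper_right_dini_gronwall:
  assumes "a \<le> b" and g: "continuous_on {a..b} g" and "0 < e"
    and dini: "\<And>t. t \<in> {a..<b} \<Longrightarrow> exp (L * (t - a)) * g a < g t \<Longrightarrow>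
      g t < exp (L * (t - a)) * g a + e \<Longrightarrow> upper_right_dini g t \<le> ereal (L * g t)"
  shows "g b \<le> exp (L * (b - a)) * g a"
proof -
  define y where "y \<epsilon> t = exp (L * (t - a)) * (g a + \<epsilon> * (1 + (t - a)))" for \<epsilon> t
  have y_deriv: "(y \<epsilon> has_real_derivative L * y \<epsilon> t + exp (L * (t - a)) * \<epsilon>) (at t)" for \<epsilon> t
    unfolding y_def by (auto intro!: derivative_eq_intros simp: algebra_simps)
  define C where "C = exp (\<bar>L\<bar> * (b - a)) * (1 + (b - a))"
  have C_pos: "0 < C" using \<open>a \<le> b\<close> by (simp add: C_def)
  have bound: "g b \<le> y \<epsilon> b" if \<epsilon>: "0 < \<epsilon>" "\<epsilon> < e / C" for \<epsilon>
  proof (rule upper_right_dini_comparison[OF \<open>a \<le> b\<close> g y_deriv])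
    show "g a \<le> y \<epsilon> a" using \<epsilon> by (simp add: y_def)
    fix t assume t: "t \<in> {a..<b}" and eq: "g t = y \<epsilon> t"
    have "L * (t - a) \<le> \<bar>L\<bar> * (b - a)"
      using t by (intro mult_mono) auto
    then have "exp (L * (t - a)) * (1 + (t - a)) \<le> C"
      using t unfolding C_def by (intro mult_mono) auto
    then have "exp (L * (t - a)) * (\<epsilon> * (1 + (t - a))) \<le> \<epsilon> * C"
      using \<epsilon> by (simp add: mult.left_commute)
    also have "\<epsilon> * C < e" using \<epsilon> C_pos by (simp add: field_simps)
    finally have "g t < exp (L * (t - a)) * g a + e"
      by (simp add: eq y_def distrib_left)
    moreover have "exp (L * (t - a)) * g a < g t"
      using t \<epsilon> by (simp add: eq y_def)
    ultimately have "upper_right_dini g t \<le> ereal (L * y \<epsilon> t)"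
      using dini[OF t] eq by simp
    then show "upper_right_dini g t < ereal (L * y \<epsilon> t + exp (L * (t - a)) * \<epsilon>)"
      using \<epsilon> by (elim order_le_less_trans) simp
  qed
  have "((\<lambda>\<epsilon>. y \<epsilon> b) \<longlongrightarrow> y 0 b) (at_right 0)"
    unfolding y_def by (intro tendsto_intros)
  moreover have "\<forall>\<^sub>F \<epsilon> in at_right 0. \<epsilon> \<in> {0<..<e / C}"
    using \<open>0 < e\<close> C_pos by (intro eventually_at_right_real) simp
  then have "\<forall>\<^sub>F \<epsilon> in at_right 0. g b \<le> y \<epsilon> b"
    by eventually_elim (auto intro: bound)
  ultimately have "g b \<le> y 0 b"
    by (rule tendsto_lowerbound) simp
  then show ?thesis by (simp add: y_def)
qed

lemma upper_right_dini_norm_le: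
  assumes "(w has_vector_derivative w') (at t)"
  shows "upper_right_dini (\<lambda>s. norm (w s)) t \<le> ereal (norm w')"
proof -
  define err where "err h = norm (w (t + h) - w t - h *\<^sub>R w') / norm h" for h
  have "(err \<longlongrightarrow> 0) (at 0)"
    using assms unfolding has_vector_derivative_def has_derivative_at err_def by simp
  then have "(err \<longlongrightarrow> 0) (at_right 0)"
    by (rule tendsto_within_subset) simp
  then have "((\<lambda>h. ereal (norm w' + err h)) \<longlongrightarrow> ereal (norm w' + 0)) (at_right 0)"
    by (intro tendsto_intros)
  then have "Limsup (at_right 0) (\<lambda>h. ereal (norm w' + err h)) = ereal (norm w')"
    by (subst lim_imp_Limsup) simp_all
  moreover have "Limsup (at_right 0) (\<lambda>h. ereal ((norm (w (t + h)) - norm (w t)) / h))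
      \<le> Limsup (at_right 0) (\<lambda>h. ereal (norm w' + err h))"
  proof (rule Limsup_mono)
    show "\<forall>\<^sub>F h in at_right 0.
        ereal ((norm (w (t + h)) - norm (w t)) / h) \<le> ereal (norm w' + err h)"
      using eventually_at_right_less[of "0::real"]
    proof eventually_elim
      case (elim h)
      have "norm (w (t + h)) - norm (w t) \<le> norm (w (t + h) - w t)"
        by (rule norm_triangle_ineq2)
      also have "\<dots> \<le> norm (h *\<^sub>R w') + norm (w (t + h) - w t - h *\<^sub>R w')"
        by (rule norm_triangle_sub)
      also have "\<dots> = h * (norm w' + err h)"
        using elim by (simp add: err_def algebra_simps)
      finally show ?case
        using elim by (simp add: pos_divide_le_eq mult.commute)
    qed
  qed
  ultimately show ?thesis
    unfolding upper_right_dini_def by simp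
qed

lemma norm_le_exp_if_norm_derivative_le:
  fixes w :: "real \<Rightarrow> 'a::real_normed_vector"
  assumes "a \<le> b" and w: "\<And>t. t \<in> {a..b} \<Longrightarrow> (w has_vector_derivative w' t) (at t)" and "0 < e"
    and bound: "\<And>t. t \<in> {a..<b} \<Longrightarrow> norm (w t) < exp (M * (t - a)) * norm (w a) + e \<Longrightarrow>
      norm (w' t) \<le> M * norm (w t)"
  shows "norm (w b) \<le> exp (M * (b - a)) * norm (w a)"
proof (rule upper_right_dini_gronwall[OF \<open>a \<le> b\<close> _ \<open>0 < e\<close>])
  show "continuous_on {a..b} (\<lambda>t. norm (w t))"
    using w by (intro continuous_on_norm continuous_at_imp_continuous_on ballI)
      (rule has_vector_derivative_continuous)
  fix t assume t: "t \<in> {a..<b}" and "norm (w t) < exp (M * (t - a)) * norm (w a) + e"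
  then have "norm (w' t) \<le> M * norm (w t)"
    using bound[OF t] by simp
  moreover have "upper_right_dini (\<lambda>t. norm (w t)) t \<le> ereal (norm (w' t))"
    using t by (intro upper_right_dini_norm_le w) simp
  ultimately show "upper_right_dini (\<lambda>t. norm (w t)) t \<le> ereal (M * norm (w t))"
    by (meson ereal_less_eq(3) order_trans)
qed

subsection \<open>Local solutions in Banach spaces\<close>

text \<open>
  The oriented integral from \<open>0\<close> is a difference of integrals starting at \<open>- \<delta>\<close>, because
  the integral over \<open>{0..t}\<close> vanishes for negative \<open>t\<close>.
\<close>

definition oriented_integral :: "real \<Rightarrow> (real \<Rightarrow> 'a::banach) \<Rightarrow> real \<Rightarrow> 'a" where
  "oriented_integral \<delta> w t = integral {- \<delta>..t} w - integral {- \<delta>..0} w"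

lemma oriented_integral_zero [simp]: "oriented_integral \<delta> w 0 = 0"
  by (simp add: oriented_integral_def)

lemma oriented_integral_has_vector_derivative:
  assumes "continuous_on {- \<delta>..\<delta>} w" and "t \<in> {- \<delta>..\<delta>}"
  shows "(oriented_integral \<delta> w has_vector_derivative w t) (at t within {- \<delta>..\<delta>})"
  unfolding oriented_integral_def
  using integral_has_vector_derivative[OF assms] by (auto intro!: derivative_eq_intros)

lemma continuous_on_oriented_integral:
  assumes "continuous_on {- \<delta>..\<delta>} w"
  shows "continuous_on {- \<delta>..\<delta>} (oriented_integral \<delta> w)"
  unfolding continuous_on_eq_continuous_within
  using oriented_integral_has_vector_derivative[OF assms] has_vector_derivative_continuous by blast

lemma oriented_integral_diff:
  assumes "continuous_on {- \<delta>..\<delta>} w" "continuous_on {- \<delta>..\<delta>} z" and "t \<in> {- \<delta>..\<delta>}"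
  shows "oriented_integral \<delta> (\<lambda>s. w s - z s) t = oriented_integral \<delta> w t - oriented_integral \<delta> z t"
proof -
  have "w integrable_on {- \<delta>..s}" "z integrable_on {- \<delta>..s}" if "s \<in> {- \<delta>..\<delta>}" for s
    using that
    by (auto intro!: integrable_continuous_interval continuous_on_subset[OF assms(1)]
        continuous_on_subset[OF assms(2)])
  then show ?thesis
    using assms(3) by (simp add: oriented_integral_def Henstock_Kurzweil_Integration.integral_diff)
qed

lemma norm_oriented_integral_le:
  assumes "continuous_on {- \<delta>..\<delta>} w" and w: "\<And>s. s \<in> {- \<delta>..\<delta>} \<Longrightarrow> norm (w s) \<le> B"
    and t: "t \<in> {- \<delta>..\<delta>}"
  shows "norm (oriented_integral \<delta> w t) \<le> \<delta> * B"
proof -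
  have "norm (oriented_integral \<delta> w t - oriented_integral \<delta> w 0) \<le> B * norm (t - 0)"
  proof (rule differentiable_bound)
    show "(oriented_integral \<delta> w has_derivative (\<lambda>h. h *\<^sub>R w s)) (at s within {- \<delta>..\<delta>})"
      if "s \<in> {- \<delta>..\<delta>}" for s
      using oriented_integral_has_vector_derivative[OF assms(1) that]
      by (simp add: has_vector_derivative_def)
    show "onorm (\<lambda>h. h *\<^sub>R w s) \<le> B" if "s \<in> {- \<delta>..\<delta>}" for s
      using w[OF that] by (simp add: onorm_scaleR_left onorm_id)
  qed (use t in auto)
  also have "\<dots> \<le> B * \<delta>"
    using t order_trans[OF norm_ge_zero w[OF t]] by (intro mult_left_mono) auto
  finally show ?thesis by (simp add: mult.commute)
qed

definition picard_map :: "('a \<Rightarrow> 'a::banach) \<Rightarrow> 'a \<Rightarrow> real \<Rightarrow> (real \<Rightarrow> 'a) \<Rightarrow> real \<Rightarrow> 'a" where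
  "picard_map g x \<delta> u t = x + oriented_integral \<delta> (g \<circ> u) t"

lemma picard_map_in_cball:
  assumes "continuous_on {- \<delta>..\<delta>} (g \<circ> u)" and "\<And>s. s \<in> {- \<delta>..\<delta>} \<Longrightarrow> norm (g (u s)) \<le> B"
    and "\<delta> * B \<le> r" and "t \<in> {- \<delta>..\<delta>}"
  shows "picard_map g x \<delta> u t \<in> cball x r"
  using norm_oriented_integral_le[of \<delta> "g \<circ> u" B t] assms by (simp add: picard_map_def dist_norm)

lemma norm_picard_map_diff_le:
  assumes "continuous_on {- \<delta>..\<delta>} (g \<circ> u)" and "continuous_on {- \<delta>..\<delta>} (g \<circ> v)"
    and "\<And>s. s \<in> {- \<delta>..\<delta>} \<Longrightarrow> norm (g (u s) - g (v s)) \<le> B" and "t \<in> {- \<delta>..\<delta>}"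
  shows "norm (picard_map g x \<delta> u t - picard_map g x \<delta> v t) \<le> \<delta> * B"
  using norm_oriented_integral_le[of \<delta> "\<lambda>s. (g \<circ> u) s - (g \<circ> v) s" B t]
    oriented_integral_diff[OF assms(1,2,4)] continuous_on_diff[OF assms(1,2)] assms(3,4)
  by (simp add: picard_map_def)

lemma continuous_on_lipschitz_comp_bcontfun:
  assumes "M-lipschitz_on K g" and "range (apply_bcontfun u) \<subseteq> K"
  shows "continuous_on T (g \<circ> apply_bcontfun u)"
  using assms(2)
  by (intro continuous_on_compose continuous_on_apply_bcontfun
      continuous_on_subset[OF lipschitz_on_continuous_on[OF assms(1)]]) auto

definition picard_operator :: "('a \<Rightarrow> 'a::banach) \<Rightarrow> 'a \<Rightarrow> real \<Rightarrow> (real \<Rightarrow>\<^sub>C 'a) \<Rightarrow> (real \<Rightarrow>\<^sub>C 'a)" where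
  "picard_operator g x \<delta> u = Bcontfun (picard_map g x \<delta> (apply_bcontfun u) \<circ> clamp (- \<delta>) \<delta>)"

lemma apply_picard_operator:
  assumes "M-lipschitz_on K g" and "range (apply_bcontfun u) \<subseteq> K"
  shows "apply_bcontfun (picard_operator g x \<delta> u) t
    = picard_map g x \<delta> (apply_bcontfun u) (clamp (- \<delta>) \<delta> t)"
proof -
  have "continuous_on (cbox (- \<delta>) \<delta>) (picard_map g x \<delta> (apply_bcontfun u))"
    unfolding picard_map_def box_real
    by (intro continuous_intros continuous_on_oriented_integral
        continuous_on_lipschitz_comp_bcontfun[OF assms])
  then obtain v :: "real \<Rightarrow>\<^sub>C 'a" where
    v: "\<And>t. apply_bcontfun v t = picard_map g x \<delta> (apply_bcontfun u) (clamp (- \<delta>) \<delta> t)"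
    by (rule continuous_on_cbox_bcontfunE) blast
  then have "picard_map g x \<delta> (apply_bcontfun u) \<circ> clamp (- \<delta>) \<delta> = apply_bcontfun v"
    by (simp add: fun_eq_iff)
  then show ?thesis
    by (simp add: picard_operator_def apply_bcontfun_inverse v)
qed

lemma dist_picard_operator_le:
  assumes lip: "M-lipschitz_on K g" and "0 \<le> \<delta>"
    and u: "range (apply_bcontfun u) \<subseteq> K" and v: "range (apply_bcontfun v) \<subseteq> K"
  shows "dist (picard_operator g x \<delta> u) (picard_operator g x \<delta> v) \<le> \<delta> * M * dist u v"
proof (rule dist_bound)
  fix t
  have "norm (g (apply_bcontfun u s) - g (apply_bcontfun v s)) \<le> M * dist u v" for s
  proof -
    have "norm (g (apply_bcontfun u s) - g (apply_bcontfun v s))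
        \<le> M * dist (apply_bcontfun u s) (apply_bcontfun v s)"
      using u v lipschitz_onD[OF lip, of "apply_bcontfun u s" "apply_bcontfun v s"]
      by (simp add: range_subsetD dist_norm)
    also have "\<dots> \<le> M * dist u v"
      by (intro mult_left_mono dist_bounded lipschitz_on_nonneg[OF lip])
    finally show ?thesis .
  qed
  moreover have "clamp (- \<delta>) \<delta> t \<in> {- \<delta>..\<delta>}"
    using clamp_in_interval[of "- \<delta>" \<delta> t] \<open>0 \<le> \<delta>\<close> by simp
  ultimately show "dist (apply_bcontfun (picard_operator g x \<delta> u) t)
      (apply_bcontfun (picard_operator g x \<delta> v) t) \<le> \<delta> * M * dist u v"
    using norm_picard_map_diff_le[OF continuous_on_lipschitz_comp_bcontfun[OF lip u]
        continuous_on_lipschitz_comp_bcontfun[OF lip v]]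
    by (simp add: apply_picard_operator[OF lip] u v dist_norm mult.assoc)
qed

lemma picard_map_fixed_point:
  fixes g :: "'a::banach \<Rightarrow> 'a"
  assumes lip: "M-lipschitz_on (cball x r) g" and bound: "\<And>y. y \<in> cball x r \<Longrightarrow> norm (g y) \<le> B"
    and \<delta>: "0 < \<delta>" "\<delta> * M < 1" "\<delta> * B \<le> r" and "0 \<le> r"
  obtains u :: "real \<Rightarrow>\<^sub>C 'a" where "range (apply_bcontfun u) \<subseteq> cball x r"
    "\<And>t. t \<in> {- \<delta>..\<delta>} \<Longrightarrow> picard_map g x \<delta> (apply_bcontfun u) t = apply_bcontfun u t"
proof -
  define X where "X = PiC UNIV (\<lambda>_::real. cball x r)"
  have X_iff: "u \<in> X \<longleftrightarrow> range (apply_bcontfun u) \<subseteq> cball x r" for u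
    unfolding X_def mem_PiC_iff by (simp add: Pi_iff image_subset_iff)
  have "\<exists>!u. u \<in> X \<and> picard_operator g x \<delta> u = u"
  proof (rule Banach_fix)
    show "complete X"
      unfolding X_def complete_eq_closed by (intro closed_PiC) simp
    have "const_bcontfun x \<in> X" using \<open>0 \<le> r\<close> by (simp add: X_iff)
    then show "X \<noteq> {}" by blast
    show "0 \<le> \<delta> * M" "\<delta> * M < 1"
      using \<delta> lipschitz_on_nonneg[OF lip] by simp_all
    show "picard_operator g x \<delta> ` X \<subseteq> X"
    proof (intro image_subsetI)
      fix u assume "u \<in> X"
      then have u: "range (apply_bcontfun u) \<subseteq> cball x r" by (simp add: X_iff)
      have "picard_map g x \<delta> (apply_bcontfun u) (clamp (- \<delta>) \<delta> t) \<in> cball x r" for t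
        using clamp_in_interval[of "- \<delta>" \<delta> t] \<delta>(1)
        by (intro picard_map_in_cball[OF continuous_on_lipschitz_comp_bcontfun[OF lip u] _ \<delta>(3)]
            bound range_subsetD[OF u]) simp
      then show "picard_operator g x \<delta> u \<in> X"
        unfolding X_iff by (intro image_subsetI) (simp only: apply_picard_operator[OF lip u])
    qed
    show "dist (picard_operator g x \<delta> u) (picard_operator g x \<delta> v) \<le> \<delta> * M * dist u v"
      if "u \<in> X" "v \<in> X" for u v
      using that \<delta>(1) by (intro dist_picard_operator_le[OF lip]) (simp_all add: X_iff)
  qed
  then obtain u where "u \<in> X" and fixed: "picard_operator g x \<delta> u = u" by blast
  then have u: "range (apply_bcontfun u) \<subseteq> cball x r" by (simp add: X_iff)
  show ?thesis
  proof
    show "picard_map g x \<delta> (apply_bcontfun u) t = apply_bcontfun u t" if "t \<in> {- \<delta>..\<delta>}" for t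
      using apply_picard_operator[OF lip u, of x \<delta> t] that by (simp add: fixed)
  qed (fact u)
qed

lemma picard_lindeloef:
  fixes g :: "'a::banach \<Rightarrow> 'a"
  assumes lip: "M-lipschitz_on (cball x r) g" and bound: "\<And>y. y \<in> cball x r \<Longrightarrow> norm (g y) \<le> B"
    and \<delta>: "0 < \<delta>" "\<delta> * M < 1" "\<delta> * B \<le> r" and "0 \<le> r"
  obtains u where "u 0 = x" "range u \<subseteq> cball x r"
    "\<And>t. t \<in> {- \<delta><..<\<delta>} \<Longrightarrow> (u has_vector_derivative g (u t)) (at t)"
proof -
  obtain u where u: "range (apply_bcontfun u) \<subseteq> cball x r"
    and fixed: "\<And>t. t \<in> {- \<delta>..\<delta>} \<Longrightarrow> picard_map g x \<delta> (apply_bcontfun u) t = apply_bcontfun u t"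
    using picard_map_fixed_point[OF assms] by blast
  show ?thesis
  proof
    show "apply_bcontfun u 0 = x"
      using fixed[of 0] \<delta>(1) by (simp add: picard_map_def)
    fix t assume t: "t \<in> {- \<delta><..<\<delta>}"
    then have "(oriented_integral \<delta> (g \<circ> apply_bcontfun u)
        has_vector_derivative g (apply_bcontfun u t)) (at t)"
      using oriented_integral_has_vector_derivative[OF
          continuous_on_lipschitz_comp_bcontfun[OF lip u], of t \<delta>]
      by (simp add: at_within_Icc_at)
    then have "(picard_map g x \<delta> (apply_bcontfun u)
        has_vector_derivative g (apply_bcontfun u t)) (at t)"
      unfolding picard_map_def by (auto intro!: derivative_eq_intros)
    then show "(apply_bcontfun u has_vector_derivative g (apply_bcontfun u t)) (at t)"
      by (rule has_vector_derivative_transform_within_open[OF _ _ t]) (simp_all add: fixed)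
  qed (fact u)
qed

subsection \<open>The flow of a locally Lipschitz vector field\<close>

lemma solves_ivpD:
  assumes "solves_ivp f D x J u"
  shows "open J" "is_interval J" "0 \<in> J" "u 0 = x"
    and "\<And>t. t \<in> J \<Longrightarrow> u t \<in> D" "\<And>t. t \<in> J \<Longrightarrow> (u has_vector_derivative f (u t)) (at t)"
  using assms by (simp_all add: solves_ivp_def)

lemma solves_ivp_closed_segment:
  assumes "solves_ivp f D x J u" "t \<in> J"
  shows "closed_segment 0 t \<subseteq> J"
  using solves_ivpD[OF assms(1)] assms(2) closed_segment_subset is_interval_convex by blast

lemma compact_solves_ivp_image:
  assumes "solves_ivp f D x J u" "T \<subseteq> J" "compact T"
  shows "compact (u ` T)"
  using assms(2) solves_ivpD(6)[OF assms(1)]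
  by (intro compact_continuous_image[OF _ assms(3)] continuous_at_imp_continuous_on ballI
      has_vector_derivative_continuous) blast

lemma solves_ivp_shift:
  assumes "solves_ivp f D x J u" and t: "t \<in> J"
  shows "solves_ivp f D (u t) {s. s + t \<in> J} (\<lambda>s. u (s + t))"
  unfolding solves_ivp_def
proof (intro conjI ballI)
  note J = solves_ivpD[OF assms(1)]
  show "open {s. s + t \<in> J}"
    using continuous_open_vimage[OF J(1), of "\<lambda>s. s + t"] by (simp add: vimage_def)
  show "is_interval {s. s + t \<in> J}"
    using J(2) unfolding is_interval_1 by (metis add_le_cancel_right mem_Collect_eq)
  show "0 \<in> {s. s + t \<in> J}" "u (0 + t) = u t" using t by auto
  fix s assume "s \<in> {s. s + t \<in> J}"
  then have s: "s + t \<in> J" by simp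
  show "u (s + t) \<in> D" using J(5)[OF s] .
  have "((\<lambda>s. s + t) has_vector_derivative 1) (at s)"
    by (auto intro!: derivative_eq_intros)
  from vector_diff_chain_at[OF this] J(6)[OF s]
  show "((\<lambda>s. u (s + t)) has_vector_derivative f (u (s + t))) (at s)"
    by (fastforce simp: o_def)
qed

locale locally_lipschitz_field =
  fixes f :: "real ^ 'n \<Rightarrow> real ^ 'n" and D :: "(real ^ 'n) set"
  assumes open_domain: "open D"
    and lipschitz_on_compact: "\<And>K. compact K \<Longrightarrow> K \<subseteq> D \<Longrightarrow> \<exists>M. M-lipschitz_on K f"
begin

lemma lipschitz_on_neighbourhood:
  assumes "compact K" "K \<subseteq> D"
  obtains r M where "0 < r" "compact (\<Union>x\<in>K. cball x r)" "(\<Union>x\<in>K. cball x r) \<subseteq> D"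
    "M-lipschitz_on (\<Union>x\<in>K. cball x r) f"
proof -
  obtain r where r: "0 < r" "(\<Union>x\<in>K. cball x r) \<subseteq> D"
    using compact_subset_open_imp_cball_epsilon_subset[OF assms(1) open_domain assms(2)] .
  have compact: "compact (\<Union>x\<in>K. cball x r)"
    by (rule compact_minkowski_sum_cball[OF assms(1)])
  obtain M where "M-lipschitz_on (\<Union>x\<in>K. cball x r) f"
    using lipschitz_on_compact[OF compact r(2)] by (rule exE)
  then show ?thesis by (rule that[OF r(1) compact r(2)])
qed

lemma uniform_local_existence:
  assumes "compact K" "K \<subseteq> D"
  shows "\<exists>\<delta>>0. \<forall>x\<in>K. \<exists>u. solves_ivp f D x {- \<delta><..<\<delta>} u"
proof -
  obtain r M where r: "0 < r" "compact (\<Union>x\<in>K. cball x r)" "(\<Union>x\<in>K. cball x r) \<subseteq> D"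
    and lip: "M-lipschitz_on (\<Union>x\<in>K. cball x r) f"
    using lipschitz_on_neighbourhood[OF assms] .
  have "bounded (f ` (\<Union>x\<in>K. cball x r))"
    using lipschitz_on_continuous_on[OF lip] r(2) compact_continuous_image compact_imp_bounded
    by blast
  then obtain B where B_pos: "0 < B"
    and bound: "\<And>y. y \<in> (\<Union>x\<in>K. cball x r) \<Longrightarrow> norm (f y) \<le> B"
    unfolding bounded_pos by blast
  have M_nonneg: "0 \<le> M" using lipschitz_on_nonneg[OF lip] .
  define \<delta> where "\<delta> = min (1 / (M + 1)) (r / B)"
  have \<delta>: "0 < \<delta>" using M_nonneg B_pos r(1) by (simp add: \<delta>_def)
  have "\<delta> * (M + 1) \<le> 1" "\<delta> * B \<le> r"
    using M_nonneg B_pos by (simp_all add: \<delta>_def min_le_iff_disj flip: pos_le_divide_eq)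
  then have small: "\<delta> * M < 1" "\<delta> * B \<le> r"
    using \<delta> by (simp_all add: distrib_left)
  have "\<exists>u. solves_ivp f D x {- \<delta><..<\<delta>} u" if "x \<in> K" for x
  proof -
    from that have sub: "cball x r \<subseteq> (\<Union>x\<in>K. cball x r)" by blast
    obtain u where u: "u 0 = x" "range u \<subseteq> cball x r"
      and deriv: "\<And>t. t \<in> {- \<delta><..<\<delta>} \<Longrightarrow> (u has_vector_derivative f (u t)) (at t)"
      using picard_lindeloef[OF lipschitz_on_subset[OF lip sub] bound[OF subsetD[OF sub]]
          \<delta> small less_imp_le[OF r(1)]] by blast
    have "range u \<subseteq> D" using u(2) sub r(3) by blast
    then have "solves_ivp f D x {- \<delta><..<\<delta>} u"
      using \<delta> u(1) deriv unfolding solves_ivp_def by auto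
    then show ?thesis by blast
  qed
  with \<delta> show ?thesis by blast
qed

text \<open>
  Rescaling time by \<open>t\<close> turns both solutions into curves on \<open>{0..1}\<close>, which treats positive and
  negative \<open>t\<close> alike.
\<close>

lemma solves_ivp_unique:
  assumes u: "solves_ivp f D x J u" and v: "solves_ivp f D x J' v" and t: "t \<in> J" "t \<in> J'"
  shows "u t = v t"
proof -
  define w where "w s = u (t * s) - v (t * s)" for s
  define w' where "w' s = t *\<^sub>R (f (u (t * s)) - f (v (t * s)))" for s
  have seg: "t * s \<in> closed_segment 0 t" if "s \<in> {0..1}" for s
    using that by (auto simp: in_segment mult.commute)
  have sub: "closed_segment 0 t \<subseteq> J" "closed_segment 0 t \<subseteq> J'"
    using solves_ivp_closed_segment u v t by blast+
  let ?K = "u ` closed_segment 0 t \<union> v ` closed_segment 0 t"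
  have "compact ?K"
    by (intro compact_Un compact_solves_ivp_image[OF u sub(1)] compact_solves_ivp_image[OF v sub(2)]
        compact_segment)
  moreover have "?K \<subseteq> D"
    using solves_ivpD(5)[OF u] solves_ivpD(5)[OF v] sub by blast
  ultimately obtain M where lip: "M-lipschitz_on ?K f"
    using lipschitz_on_compact by blast
  have "norm (w 1) \<le> exp (\<bar>t\<bar> * M * (1 - 0)) * norm (w 0)"
  proof (rule norm_le_exp_if_norm_derivative_le[where e = 1])
    fix s :: real assume "s \<in> {0..1}"
    then have s: "t * s \<in> J" "t * s \<in> J'" using seg sub by blast+
    have "((\<lambda>s. t * s) has_vector_derivative t) (at s)"
      by (auto intro!: derivative_eq_intros)
    note chain = vector_diff_chain_at[OF this]
    show "(w has_vector_derivative w' s) (at s)"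
      unfolding w_def w'_def scaleR_diff_right
      using chain[OF solves_ivpD(6)[OF u s(1)]] chain[OF solves_ivpD(6)[OF v s(2)]]
      by (intro has_vector_derivative_diff) (simp_all add: o_def)
  next
    fix s :: real assume "s \<in> {0..<1}"
    then have "norm (f (u (t * s)) - f (v (t * s))) \<le> M * norm (w s)"
      unfolding w_def using seg[of s] by (intro lipschitz_on_normD[OF lip]) auto
    then show "norm (w' s) \<le> \<bar>t\<bar> * M * norm (w s)"
      by (simp add: w'_def mult.assoc mult_left_mono)
  qed simp_all
  also have "w 0 = 0"
    using solves_ivpD(4)[OF u] solves_ivpD(4)[OF v] by (simp add: w_def)
  finally show ?thesis by (simp add: w_def)
qed

lemma solves_ivp_imp_flow:
  assumes "solves_ivp f D x J u" and "t \<in> J"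
  shows "t \<in> existence_ivl f D x" "flow f D t x = u t"
proof -
  show "t \<in> existence_ivl f D x" unfolding existence_ivl_def using assms by blast
  show "flow f D t x = u t"
    unfolding flow_def by (rule the_equality) (use assms solves_ivp_unique in blast)+
qed

lemma solves_ivp_flow:
  assumes x: "x \<in> D"
  shows "solves_ivp f D x (existence_ivl f D x) (\<lambda>t. flow f D t x)"
proof -
  obtain J0 u0 where u0: "solves_ivp f D x J0 u0"
    using uniform_local_existence[of "{x}"] x by auto
  have "open (existence_ivl f D x)"
    unfolding existence_ivl_def solves_ivp_def by blast
  moreover have "is_interval (existence_ivl f D x)"
    unfolding is_interval_connected_1 existence_ivl_def
    by (rule connected_Union) (auto simp: solves_ivp_def is_interval_connected_1)
  moreover have "flow f D t x \<in> D \<and>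
      ((\<lambda>t. flow f D t x) has_vector_derivative f (flow f D t x)) (at t)"
    if "t \<in> existence_ivl f D x" for t
  proof -
    obtain J u where u: "solves_ivp f D x J u" and t: "t \<in> J"
      using \<open>t \<in> existence_ivl f D x\<close> unfolding existence_ivl_def by blast
    have "((\<lambda>t. flow f D t x) has_vector_derivative f (u t)) (at t)"
      by (rule has_vector_derivative_transform_within_open[OF solves_ivpD(6)[OF u t]
            solves_ivpD(1)[OF u] t]) (simp add: solves_ivp_imp_flow(2)[OF u])
    then show ?thesis
      using solves_ivp_imp_flow(2)[OF u t] solves_ivpD(5)[OF u t] by simp
  qed
  ultimately show ?thesis
    unfolding solves_ivp_def
    using solves_ivp_imp_flow[OF u0 solves_ivpD(3)[OF u0]] solves_ivpD(4)[OF u0] by blast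
qed

lemma open_existence_ivl: "x \<in> D \<Longrightarrow> open (existence_ivl f D x)"
  by (rule solves_ivpD(1)[OF solves_ivp_flow])

lemma zero_in_existence_ivl [simp]: "x \<in> D \<Longrightarrow> 0 \<in> existence_ivl f D x"
  and flow_zero [simp]: "x \<in> D \<Longrightarrow> flow f D 0 x = x"
  by (simp_all add: solves_ivpD[OF solves_ivp_flow])

lemma flow_in_domain: "x \<in> D \<Longrightarrow> t \<in> existence_ivl f D x \<Longrightarrow> flow f D t x \<in> D"
  by (rule solves_ivpD(5)[OF solves_ivp_flow])

lemma flow_has_vector_derivative:
  "x \<in> D \<Longrightarrow> t \<in> existence_ivl f D x \<Longrightarrow>
    ((\<lambda>t. flow f D t x) has_vector_derivative f (flow f D t x)) (at t)"
  by (rule solves_ivpD(6)[OF solves_ivp_flow])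

lemma isCont_flow: "x \<in> D \<Longrightarrow> t \<in> existence_ivl f D x \<Longrightarrow> isCont (\<lambda>t. flow f D t x) t"
  by (rule has_vector_derivative_continuous[OF flow_has_vector_derivative])

lemma Icc_subset_existence_ivl:
  assumes "x \<in> D" "T \<in> existence_ivl f D x"
  shows "{0..T} \<subseteq> existence_ivl f D x"
  using solves_ivp_closed_segment[OF solves_ivp_flow assms(2)] assms(1)
  by (cases "0 \<le> T") (simp_all add: closed_segment_eq_real_ivl1)

lemma flow_add:
  assumes x: "x \<in> D" and t: "t \<in> existence_ivl f D x"
    and s: "s \<in> existence_ivl f D (flow f D t x)"
  shows "s + t \<in> existence_ivl f D x" "flow f D (s + t) x = flow f D s (flow f D t x)"
proof -
  let ?y = "flow f D t x"
  have y: "?y \<in> D" using flow_in_domain x t by blast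
  have "solves_ivp f D ?y {s. s + t \<in> existence_ivl f D x} (\<lambda>s. flow f D (s + t) x)"
    using solves_ivp_shift[OF solves_ivp_flow[OF x] t] .
  from solves_ivp_imp_flow[OF this, of "- t"] x
  have neg_t: "- t \<in> existence_ivl f D ?y" "flow f D (- t) ?y = x" by simp_all
  have "solves_ivp f D x {r. r + - t \<in> existence_ivl f D ?y} (\<lambda>r. flow f D (r + - t) ?y)"
    using solves_ivp_shift[OF solves_ivp_flow[OF y] neg_t(1)] unfolding neg_t(2) .
  from solves_ivp_imp_flow[OF this, of "s + t"] s
  show "s + t \<in> existence_ivl f D x" "flow f D (s + t) x = flow f D s ?y" by simp_all
qed

lemma flow_equilibrium:
  assumes "x \<in> D" "f x = 0"
  shows "t \<in> existence_ivl f D x" "flow f D t x = x"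
proof -
  have "solves_ivp f D x UNIV (\<lambda>_. x)"
    using assms by (simp add: solves_ivp_def)
  from solves_ivp_imp_flow[OF this, of t]
  show "t \<in> existence_ivl f D x" "flow f D t x = x" by simp_all
qed

lemma limit_in_existence_ivl:
  assumes "compact K" "K \<subseteq> D" and x: "x \<in> D"
    and a: "\<And>n. a n \<in> existence_ivl f D x" "\<And>n. flow f D (a n) x \<in> K" and lim: "a \<longlonglongrightarrow> T"
  shows "T \<in> existence_ivl f D x"
proof -
  obtain \<delta> where \<delta>: "0 < \<delta>" "\<And>y. y \<in> K \<Longrightarrow> \<exists>u. solves_ivp f D y {- \<delta><..<\<delta>} u"
    using uniform_local_existence[OF assms(1,2)] by blast
  obtain n where "dist (a n) T < \<delta>"
    using lim \<delta>(1) eventually_happens[OF tendstoD] sequentially_bot by blast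
  then have "T - a n \<in> {- \<delta><..<\<delta>}" by (auto simp: dist_real_def)
  then have "T - a n \<in> existence_ivl f D (flow f D (a n) x)"
    using \<delta>(2)[OF a(2)] solves_ivp_imp_flow(1) by blast
  then show ?thesis
    using flow_add(1)[OF x a(1), of "T - a n" n] by simp
qed

subsection \<open>Continuous dependence on the initial value\<close>

lemma norm_flow_diff_le_exp:
  assumes x: "x \<in> D" "T \<in> existence_ivl f D x" and y: "y \<in> D" "T \<in> existence_ivl f D y"
    and "0 \<le> T" "0 < e"
    and lip: "\<And>t. t \<in> {0..T} \<Longrightarrow> norm (flow f D t x - flow f D t y) < exp (M * t) * norm (x - y) + e \<Longrightarrow>
      norm (f (flow f D t x) - f (flow f D t y)) \<le> M * norm (flow f D t x - flow f D t y)"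
  shows "norm (flow f D T x - flow f D T y) \<le> exp (M * T) * norm (x - y)"
proof -
  define w where "w t = flow f D t x - flow f D t y" for t
  have "norm (w T) \<le> exp (M * (T - 0)) * norm (w 0)"
  proof (rule norm_le_exp_if_norm_derivative_le[OF \<open>0 \<le> T\<close> _ \<open>0 < e\<close>])
    fix t assume "t \<in> {0..T}"
    then have "t \<in> existence_ivl f D x" "t \<in> existence_ivl f D y"
      using Icc_subset_existence_ivl x y by blast+
    then show "(w has_vector_derivative f (flow f D t x) - f (flow f D t y)) (at t)"
      unfolding w_def by (intro has_vector_derivative_diff flow_has_vector_derivative x(1) y(1))
  qed (use lip x y in \<open>simp add: w_def\<close>)
  then show ?thesis using x y by (simp add: w_def)
qed

lemma flow_stays_near:
  assumes x: "x \<in> D" "\<tau> \<in> existence_ivl f D x" and y: "y \<in> D" "\<tau> \<in> existence_ivl f D y"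
    and lip: "M-lipschitz_on (\<Union>s\<in>{0..\<tau>}. cball (flow f D s y) r) f"
    and small: "exp (M * \<tau>) * norm (x - y) < r" and t: "t \<in> {0..\<tau>}"
  shows "flow f D t x \<in> cball (flow f D t y) r"
proof -
  define e where "e = r - exp (M * \<tau>) * norm (x - y)"
  have exp_le: "exp (M * s) * norm (x - y) \<le> exp (M * \<tau>) * norm (x - y)" if "s \<in> {0..\<tau>}" for s
    using that lipschitz_on_nonneg[OF lip] by (simp add: mult_left_mono mult_right_mono)
  have "norm (flow f D t x - flow f D t y) \<le> exp (M * t) * norm (x - y)"
  proof (rule norm_flow_diff_le_exp)
    show "0 < e" using small by (simp add: e_def)
    fix s assume "s \<in> {0..t}"
      and "norm (flow f D s x - flow f D s y) < exp (M * s) * norm (x - y) + e"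
    then have s: "s \<in> {0..\<tau>}" and close: "norm (flow f D s x - flow f D s y) \<le> r"
      using t exp_le[of s] by (auto simp: e_def)
    have "0 \<le> r" using close norm_ge_zero order_trans by blast
    then show "norm (f (flow f D s x) - f (flow f D s y)) \<le> M * norm (flow f D s x - flow f D s y)"
      using s close by (intro lipschitz_on_normD[OF lip] UN_I[OF s])
        (simp_all add: dist_norm norm_minus_commute)
  qed (use t x y Icc_subset_existence_ivl[OF x] Icc_subset_existence_ivl[OF y] in auto)
  then show ?thesis
    using exp_le[OF t] small by (simp add: dist_norm norm_minus_commute)
qed

lemma local_lipschitz_flow:
  assumes "0 \<le> \<tau>"
  shows "local_lipschitz {0..\<tau>} {x \<in> D. \<tau> \<in> existence_ivl f D x} (flow f D)"
proof (rule local_lipschitzI)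
  let ?X = "{x \<in> D. \<tau> \<in> existence_ivl f D x}"
  fix t x0 assume "x0 \<in> ?X"
  then have x0: "x0 \<in> D" "\<tau> \<in> existence_ivl f D x0" by auto
  have "compact ((\<lambda>s. flow f D s x0) ` {0..\<tau>})" "(\<lambda>s. flow f D s x0) ` {0..\<tau>} \<subseteq> D"
    using compact_solves_ivp_image[OF solves_ivp_flow] Icc_subset_existence_ivl x0 flow_in_domain
    by blast+
  then obtain r M where r: "0 < r" and lip: "M-lipschitz_on (\<Union>s\<in>{0..\<tau>}. cball (flow f D s x0) r) f"
    by (rule lipschitz_on_neighbourhood) simp
  define \<rho> where "\<rho> = r / (2 * exp (M * \<tau>))"
  have near: "flow f D s x \<in> cball (flow f D s x0) r" if "x \<in> cball x0 \<rho> \<inter> ?X" "s \<in> {0..\<tau>}" for x s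
  proof -
    have "exp (M * \<tau>) * norm (x - x0) \<le> exp (M * \<tau>) * \<rho>"
      using that by (simp add: dist_norm norm_minus_commute)
    also have "\<dots> < r" using r by (simp add: \<rho>_def)
    finally show ?thesis
      using that by (intro flow_stays_near[OF _ _ x0 lip]) auto
  qed
  have "(exp (M * \<tau>))-lipschitz_on (cball x0 \<rho> \<inter> ?X) (flow f D s)" if s: "s \<in> {0..\<tau>}" for s
  proof (rule lipschitz_onI)
    fix x y assume x: "x \<in> cball x0 \<rho> \<inter> ?X" and y: "y \<in> cball x0 \<rho> \<inter> ?X"
    have "norm (flow f D s x - flow f D s y) \<le> exp (M * s) * norm (x - y)"
    proof (rule norm_flow_diff_le_exp[where e = 1])
      fix q assume "q \<in> {0..s}"
      then have "q \<in> {0..\<tau>}" using s by simp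
      then show "norm (f (flow f D q x) - f (flow f D q y))
          \<le> M * norm (flow f D q x - flow f D q y)"
        using near x y by (intro lipschitz_on_normD[OF lip]) blast+
    qed (use x y s Icc_subset_existence_ivl[of x \<tau>] Icc_subset_existence_ivl[of y \<tau>] in auto)
    also have "\<dots> \<le> exp (M * \<tau>) * norm (x - y)"
      using s lipschitz_on_nonneg[OF lip] by (simp add: mult_left_mono mult_right_mono)
    finally show "dist (flow f D s x) (flow f D s y) \<le> exp (M * \<tau>) * dist x y"
      by (simp add: dist_norm)
  qed simp
  moreover have "0 < \<rho>" using r by (simp add: \<rho>_def)
  ultimately show "\<exists>u>0. \<exists>L. \<forall>s\<in>cball t u \<inter> {0..\<tau>}. L-lipschitz_on (cball x0 u \<inter> ?X) (flow f D s)"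
    by blast
qed

lemma continuous_on_flow:
  assumes "0 \<le> \<tau>"
  shows "continuous_on ({0..\<tau>} \<times> {x \<in> D. \<tau> \<in> existence_ivl f D x}) (\<lambda>(t, x). flow f D t x)"
proof (rule continuous_on_TimesI[OF local_lipschitz_flow[OF assms]])
  fix x assume "x \<in> {x \<in> D. \<tau> \<in> existence_ivl f D x}"
  then show "continuous_on {0..\<tau>} (\<lambda>t. flow f D t x)"
    using Icc_subset_existence_ivl[of x \<tau>]
    by (intro continuous_at_imp_continuous_on ballI isCont_flow) auto
qed

lemma compact_reachable_tube:
  assumes S: "compact S" "S \<subseteq> D" and \<tau>: "0 \<le> \<tau>" "\<And>x. x \<in> S \<Longrightarrow> \<tau> \<in> existence_ivl f D x"
  shows "compact (reachable_tube f D \<tau> S)" "reachable_tube f D \<tau> S \<subseteq> D"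
proof -
  show "reachable_tube f D \<tau> S \<subseteq> D"
    unfolding reachable_tube_def using flow_in_domain S(2) by blast
  have "{0..\<tau>} \<subseteq> existence_ivl f D x" if "x \<in> S" for x
    using that S(2) \<tau>(2) by (intro Icc_subset_existence_ivl) auto
  then have "reachable_tube f D \<tau> S = (\<lambda>(t, x). flow f D t x) ` ({0..\<tau>} \<times> S)"
    unfolding reachable_tube_def by force
  moreover have "continuous_on ({0..\<tau>} \<times> S) (\<lambda>(t, x). flow f D t x)"
    using S(2) \<tau>(2) by (intro continuous_on_subset[OF continuous_on_flow[OF \<tau>(1)]]) auto
  ultimately show "compact (reachable_tube f D \<tau> S)"
    using S(1) by (simp add: compact_continuous_image compact_Times)
qed

end

subsection \<open>Norms, weak pairings and one-sided Lipschitz constants\<close>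

lemma is_normD:
  assumes "is_norm N"
  shows "0 \<le> N x" "N x = 0 \<longleftrightarrow> x = 0" "N (c *\<^sub>R x) = \<bar>c\<bar> * N x" "N (x + y) \<le> N x + N y"
  using assms by (simp_all add: is_norm_def)

lemma is_norm_pos: "is_norm N \<Longrightarrow> x \<noteq> 0 \<Longrightarrow> 0 < N x"
  using is_normD(1,2)[of N x] by (simp add: less_le)

lemma continuous_on_is_norm:
  assumes N: "is_norm N"
  shows "continuous_on T N"
proof -
  have "convex_on UNIV N"
  proof (rule convex_onI)
    fix t :: real and x y :: "real ^ 'a" assume "0 < t" "t < 1"
    then show "N ((1 - t) *\<^sub>R x + t *\<^sub>R y) \<le> (1 - t) * N x + t * N y"
      using is_normD(4)[OF N, of "(1 - t) *\<^sub>R x" "t *\<^sub>R y"] by (simp add: is_normD(3)[OF N])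
  qed simp
  then have "continuous_on UNIV N"
    by (intro convex_on_continuous) simp_all
  then show ?thesis by (rule continuous_on_subset) simp
qed

lemma is_norm_equivalent:
  assumes N: "is_norm N"
  shows "\<exists>c>0. \<exists>C>0. \<forall>x. c * norm x \<le> N x \<and> N x \<le> C * norm x"
proof -
  have sphere: "compact (sphere 0 1 :: (real ^ 'a) set)" "sphere 0 1 \<noteq> ({} :: (real ^ 'a) set)"
    by simp_all
  obtain a where a: "norm a = 1" "\<And>x. norm x = 1 \<Longrightarrow> N a \<le> N x"
    using continuous_attains_inf[OF sphere continuous_on_is_norm[OF N]] by auto
  obtain b where b: "norm b = 1" "\<And>x. norm x = 1 \<Longrightarrow> N x \<le> N b"
    using continuous_attains_sup[OF sphere continuous_on_is_norm[OF N]] by auto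
  have scale: "N x = norm x * N (sgn x)" for x
    by (cases "x = 0") (simp_all add: sgn_div_norm is_normD(3)[OF N] is_normD(2)[OF N, of 0])
  have "N a * norm x \<le> N x \<and> N x \<le> N b * norm x" for x
  proof (cases "x = 0")
    case True
    then show ?thesis using is_normD(2)[OF N, of 0] by simp
  next
    case False
    then have "N a \<le> N (sgn x)" "N (sgn x) \<le> N b"
      using a(2) b(2) by (simp_all add: norm_sgn)
    then show ?thesis
      by (simp add: scale[of x] mult.commute[of _ "norm x"] mult_left_mono)
  qed
  moreover have "a \<noteq> 0" "b \<noteq> 0" using a(1) b(1) by auto
  then have "0 < N a" "0 < N b" by (simp_all add: is_norm_pos[OF N])
  ultimately show ?thesis by blast
qed

lemma lipschitz_const_over_imp_lipschitz_on:
  assumes N: "is_norm N" and f: "lipschitz_const_over N f K M"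
  shows "\<exists>M'. M'-lipschitz_on K f"
proof -
  obtain c C where pos: "0 < c" "0 < C" and lower: "\<And>x. c * norm x \<le> N x"
    and upper: "\<And>x. N x \<le> C * norm x"
    using is_norm_equivalent[OF N] by metis
  have M_nonneg: "0 \<le> M" using f by (simp add: lipschitz_const_over_def)
  have "(M * C / c)-lipschitz_on K f"
  proof (rule lipschitz_onI)
    fix x y assume "x \<in> K" "y \<in> K"
    have "c * norm (f x - f y) \<le> N (f x - f y)" by (rule lower)
    also have "\<dots> \<le> M * N (x - y)"
      using f \<open>x \<in> K\<close> \<open>y \<in> K\<close> by (simp add: lipschitz_const_over_def)
    also have "\<dots> \<le> M * (C * norm (x - y))"
      by (intro mult_left_mono upper M_nonneg)
    finally show "dist (f x) (f y) \<le> M * C / c * dist x y"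
      using pos(1) by (simp add: dist_norm field_simps)
  qed (use M_nonneg pos in simp)
  then show ?thesis by blast
qed

lemma locally_lipschitz_imp_field:
  assumes "is_norm N" "open D" "locally_lipschitz N D f"
  shows "locally_lipschitz_field f D"
  using assms lipschitz_const_over_imp_lipschitz_on
  unfolding locally_lipschitz_field_def locally_lipschitz_def by blast

lemma weak_pairing_cauchy_schwarz:
  assumes "associated_weak_pairing N wp"
  shows "wp x y \<le> N x * N y"
  using assms unfolding associated_weak_pairing_def weak_pairing_def by (metis abs_le_D1)

lemma upper_right_dini_le_if_weak_pairing_le:
  assumes wp: "associated_weak_pairing N wp"
    and J: "open J" "\<And>s. s \<in> J \<Longrightarrow> (u has_vector_derivative u' s) (at s)" and t: "t \<in> J"
    and pos: "0 < N (u t)" and bound: "wp (u' t) (u t) \<le> L * (N (u t))\<^sup>2"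
  shows "upper_right_dini (\<lambda>s. N (u s)) t \<le> ereal (L * N (u t))"
proof -
  obtain e where e: "0 < e" "ball t e \<subseteq> J" using J(1) t openE by blast
  then have "\<forall>s\<in>{t - e<..<t + e}. (u has_vector_derivative u' s) (at s)"
    using J(2) by (auto simp: ball_eq_greaterThanLessThan)
  moreover have "t \<in> {t - e<..<t + e}" using e(1) by simp
  ultimately have formula:
    "ereal (N (u t)) * upper_right_dini (\<lambda>s. N (u s)) t = ereal (wp (u' t) (u t))"
    using wp unfolding associated_weak_pairing_def curve_norm_derivative_formula_def by blast
  then obtain d where d: "upper_right_dini (\<lambda>s. N (u s)) t = ereal d"
    using pos by (cases "upper_right_dini (\<lambda>s. N (u s)) t") auto
  have "N (u t) * d \<le> N (u t) * (L * N (u t))"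
    using formula bound by (simp add: d power2_eq_square mult_ac)
  then show ?thesis using pos by (simp add: d)
qed

lemma norm_le_exp_if_weak_pairing_le:
  assumes N: "is_norm N" and wp: "associated_weak_pairing N wp" and "a \<le> b"
    and J: "open J" "{a..b} \<subseteq> J" "\<And>s. s \<in> J \<Longrightarrow> (u has_vector_derivative u' s) (at s)"
    and bound: "\<And>t. t \<in> {a..<b} \<Longrightarrow> wp (u' t) (u t) \<le> L * (N (u t))\<^sup>2"
  shows "N (u b) \<le> exp (L * (b - a)) * N (u a)"
proof (rule upper_right_dini_gronwall[OF \<open>a \<le> b\<close>, where e = 1])
  have "continuous_on {a..b} u"
    using J(2,3)
    by (intro continuous_at_imp_continuous_on ballI has_vector_derivative_continuous) blast
  then show "continuous_on {a..b} (\<lambda>t. N (u t))"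
    by (rule continuous_on_compose2[OF continuous_on_is_norm[OF N, of UNIV]]) simp
  fix t assume t: "t \<in> {a..<b}" and above: "exp (L * (t - a)) * N (u a) < N (u t)"
  have "0 \<le> exp (L * (t - a)) * N (u a)" by (simp add: is_normD(1)[OF N])
  with above have "0 < N (u t)" by linarith
  then show "upper_right_dini (\<lambda>t. N (u t)) t \<le> ereal (L * N (u t))"
    using t J by (intro upper_right_dini_le_if_weak_pairing_le[OF wp J(1,3) _ _ bound]) auto
qed simp

definition one_sided_lipschitz_over ::
    "(real ^ 'n \<Rightarrow> real) \<Rightarrow> (real ^ 'n \<Rightarrow> real ^ 'n \<Rightarrow> real) \<Rightarrow>
     (real ^ 'n \<Rightarrow> real ^ 'n) \<Rightarrow> (real ^ 'n) set \<Rightarrow> real \<Rightarrow> bool" where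
  "one_sided_lipschitz_over N wp f K L \<longleftrightarrow>
     (\<forall>x\<in>K. \<forall>y\<in>K. wp (f y - f x) (y - x) \<le> L * (N (y - x))\<^sup>2)"

lemma lipschitz_const_over_imp_one_sided:
  assumes N: "is_norm N" and wp: "associated_weak_pairing N wp"
    and f: "lipschitz_const_over N f K M"
  shows "one_sided_lipschitz_over N wp f K M"
  unfolding one_sided_lipschitz_over_def
proof (intro ballI)
  fix x y assume "x \<in> K" "y \<in> K"
  have "wp (f y - f x) (y - x) \<le> N (f y - f x) * N (y - x)"
    by (rule weak_pairing_cauchy_schwarz[OF wp])
  also have "\<dots> \<le> M * N (y - x) * N (y - x)"
    using f \<open>x \<in> K\<close> \<open>y \<in> K\<close> is_normD(1)[OF N]
    unfolding lipschitz_const_over_def by (intro mult_right_mono) auto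
  finally show "wp (f y - f x) (y - x) \<le> M * (N (y - x))\<^sup>2"
    by (simp add: power2_eq_square mult.assoc)
qed

text \<open>
  The \<open>LEAST\<close> in the constant is attained only if there are two distinct points: over a single
  point every real number is a one-sided Lipschitz constant.
\<close>

lemma
  assumes N: "is_norm N" and one_sided: "one_sided_lipschitz_over N wp f K M"
    and ab: "a \<in> K" "b \<in> K" "a \<noteq> b"
  shows one_sided_lipschitz_over_const:
      "one_sided_lipschitz_over N wp f K (one_sided_lipschitz_const N wp f K)"
    and one_sided_lipschitz_const_le: "one_sided_lipschitz_const N wp f K \<le> M"
proof -
  define admissible where "admissible = Collect (one_sided_lipschitz_over N wp f K)"
  have admissible_eq: "admissible = (\<Inter>x\<in>K. \<Inter>y\<in>K. {L. wp (f y - f x) (y - x) \<le> L * (N (y - x))\<^sup>2})"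
    by (auto simp: admissible_def one_sided_lipschitz_over_def)
  have "closed admissible"
    unfolding admissible_eq by (intro closed_INT ballI closed_Collect_le continuous_intros)
  moreover have "M \<in> admissible" using one_sided by (simp add: admissible_def)
  moreover have bdd: "bdd_below admissible"
  proof (rule bdd_belowI)
    fix L assume "L \<in> admissible"
    then have "wp (f b - f a) (b - a) \<le> L * (N (b - a))\<^sup>2"
      using ab by (simp add: admissible_eq)
    then show "wp (f b - f a) (b - a) / (N (b - a))\<^sup>2 \<le> L"
      using is_norm_pos[OF N, of "b - a"] ab(3) by (simp add: divide_le_eq)
  qed
  ultimately have "Inf admissible \<in> admissible" by (intro closed_contains_Inf) auto
  moreover have lower: "Inf admissible \<le> L" if "L \<in> admissible" for L
    using cInf_lower[OF that bdd] .
  ultimately have "one_sided_lipschitz_const N wp f K = Inf admissible"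
    unfolding one_sided_lipschitz_const_def one_sided_lipschitz_over_def[symmetric]
    by (intro Least_equality) (simp_all add: admissible_def)
  then show "one_sided_lipschitz_over N wp f K (one_sided_lipschitz_const N wp f K)"
    and "one_sided_lipschitz_const N wp f K \<le> M"
    using \<open>Inf admissible \<in> admissible\<close> lower[OF \<open>M \<in> admissible\<close>] by (simp_all add: admissible_def)
qed

lemma exp_eq_h_fun: "exp (L * r) = 1 + L * h_fun r L"
  by (simp add: h_fun_def)

lemma h_fun_mono: "r \<le> s \<Longrightarrow> h_fun r L \<le> h_fun s L"
  by (cases "L > 0") (auto simp: h_fun_def divide_right_mono intro!: divide_right_mono_neg)

lemma h_fun_nonneg: "0 \<le> r \<Longrightarrow> 0 \<le> h_fun r L"
  using h_fun_mono[of 0 r L] by (simp add: h_fun_def split: if_splits)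

lemma exp_le_h_fun:
  assumes "L \<le> M" "0 \<le> M" "0 \<le> r" "r \<le> \<tau>"
  shows "exp (L * r) \<le> 1 + M * h_fun \<tau> L"
proof -
  have "L * h_fun r L \<le> M * h_fun r L"
    by (intro mult_right_mono h_fun_nonneg assms)
  also have "\<dots> \<le> M * h_fun \<tau> L"
    by (intro mult_left_mono h_fun_mono assms)
  finally show ?thesis by (simp add: exp_eq_h_fun)
qed

subsection \<open>Recurrence and decay along the flow\<close>

context locally_lipschitz_field
begin

lemma norm_flow_diff_le_one_sided_exp:
  assumes N: "is_norm N" and wp: "associated_weak_pairing N wp" and r: "0 \<le> r"
    and x: "x \<in> D" "r \<in> existence_ivl f D x" and y: "y \<in> D" "r \<in> existence_ivl f D y"
    and L: "\<And>s. s \<in> {0..<r} \<Longrightarrow> wp (f (flow f D s x) - f (flow f D s y)) (flow f D s x - flow f D s y)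
      \<le> L * (N (flow f D s x - flow f D s y))\<^sup>2"
  shows "N (flow f D r x - flow f D r y) \<le> exp (L * r) * N (x - y)"
proof -
  define u where "u s = flow f D s x - flow f D s y" for s
  define J where "J = existence_ivl f D x \<inter> existence_ivl f D y"
  have "N (u r) \<le> exp (L * (r - 0)) * N (u 0)"
  proof (rule norm_le_exp_if_weak_pairing_le[OF N wp r])
    show "open J" unfolding J_def by (intro open_Int open_existence_ivl x(1) y(1))
    show "{0..r} \<subseteq> J" unfolding J_def using Icc_subset_existence_ivl x y by blast
    show "(u has_vector_derivative f (flow f D s x) - f (flow f D s y)) (at s)" if "s \<in> J" for s
      unfolding u_def using that x(1) y(1)
      by (intro has_vector_derivative_diff flow_has_vector_derivative) (simp_all add: J_def)
  qed (use L in \<open>simp add: u_def\<close>)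
  then show ?thesis using x(1) y(1) by (simp add: u_def)
qed

definition decay_times :: "(real ^ 'n) set \<Rightarrow> (real ^ 'n \<Rightarrow> real) \<Rightarrow> real \<Rightarrow> real ^ 'n \<Rightarrow> real set" where
  "decay_times S V \<alpha> x = {t \<in> {0..} \<inter> existence_ivl f D x.
     flow f D t x \<in> S \<and> exp (\<alpha> * t) * V (flow f D t x) \<le> V x}"

lemma decay_timesD:
  assumes "t \<in> decay_times S V \<alpha> x"
  shows "0 \<le> t" "t \<in> existence_ivl f D x" "flow f D t x \<in> S" "exp (\<alpha> * t) * V (flow f D t x) \<le> V x"
  using assms by (simp_all add: decay_times_def)

lemma zero_in_decay_times: "x \<in> S \<Longrightarrow> x \<in> D \<Longrightarrow> 0 \<in> decay_times S V \<alpha> x"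
  by (simp add: decay_times_def)

lemma decay_times_add:
  assumes x: "x \<in> D" and m: "m \<in> decay_times S V \<alpha> x" and s: "s \<in> decay_times S V \<alpha> (flow f D m x)"
  shows "s + m \<in> decay_times S V \<alpha> x"
proof -
  note m = decay_timesD[OF m] and s = decay_timesD[OF s]
  note flow_add = flow_add[OF x m(2) s(2)]
  have "exp (\<alpha> * (s + m)) * V (flow f D (s + m) x)
      = exp (\<alpha> * m) * (exp (\<alpha> * s) * V (flow f D s (flow f D m x)))"
    by (simp add: flow_add exp_add distrib_left)
  also have "\<dots> \<le> exp (\<alpha> * m) * V (flow f D m x)"
    using s(4) by simp
  finally show ?thesis
    using m s flow_add by (simp add: decay_times_def)
qed

lemma closed_decay_times:
  assumes S: "compact S" "S \<subseteq> D" and V: "continuous_on S V" and x: "x \<in> D"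
  shows "closed (decay_times S V \<alpha> x)"
  unfolding closed_sequential_limits
proof (intro allI impI, elim conjE)
  fix a T assume "\<forall>n. a n \<in> decay_times S V \<alpha> x" and lim: "a \<longlonglongrightarrow> T"
  then have "a n \<in> decay_times S V \<alpha> x" for n by simp
  note a = decay_timesD[OF this]
  have T: "T \<in> existence_ivl f D x"
    using limit_in_existence_ivl[OF S x a(2,3) lim] .
  have flow_lim: "(\<lambda>n. flow f D (a n) x) \<longlonglongrightarrow> flow f D T x"
    using isCont_tendsto_compose[OF isCont_flow[OF x T] lim] .
  have in_S: "flow f D T x \<in> S"
    using closed_sequentially[OF compact_imp_closed[OF S(1)] a(3) flow_lim] .
  have "(\<lambda>n. V (flow f D (a n) x)) \<longlonglongrightarrow> V (flow f D T x)"
    using continuous_on_tendsto_compose[OF V flow_lim in_S] a(3) by simp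
  then have "(\<lambda>n. exp (\<alpha> * a n) * V (flow f D (a n) x)) \<longlonglongrightarrow> exp (\<alpha> * T) * V (flow f D T x)"
    by (intro tendsto_intros lim)
  then have "exp (\<alpha> * T) * V (flow f D T x) \<le> V x"
    using a(4) by (intro LIMSEQ_le_const2) auto
  moreover have "0 \<le> T"
    using a(1) by (intro LIMSEQ_le_const[OF lim]) auto
  ultimately show "T \<in> decay_times S V \<alpha> x"
    using T in_S by (simp add: decay_times_def)
qed

text \<open>
  The recurrence steps may shrink, so a decay time in \<open>[t - \<tau>, t]\<close> is found not by iteration but as
  the last decay time up to \<open>t\<close>.
\<close>

lemma decay_time_within:
  assumes S: "compact S" "S \<subseteq> D" and V: "continuous_on S V"
    and recurrent: "\<And>y. y \<in> S \<Longrightarrow> \<exists>s\<in>decay_times S V \<alpha> y. 0 < s \<and> s \<le> \<tau>"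
    and x: "x \<in> S" and t: "0 \<le> t"
  obtains m where "m \<in> decay_times S V \<alpha> x" "m \<le> t" "t - m \<le> \<tau>"
    "t - m \<in> existence_ivl f D (flow f D m x)"
proof -
  have xD: "x \<in> D" using x S(2) by blast
  define past where "past = decay_times S V \<alpha> x \<inter> {..t}"
  have "closed past"
    unfolding past_def by (intro closed_Int closed_decay_times S V xD closed_atMost)
  moreover have "0 \<in> past"
    using zero_in_decay_times[OF x xD] t by (simp add: past_def)
  moreover have bdd: "bdd_above past"
    unfolding past_def by (intro bdd_aboveI[of _ t]) simp
  ultimately have "Sup past \<in> past" by (intro closed_contains_Sup) auto
  then have m: "Sup past \<in> decay_times S V \<alpha> x" "Sup past \<le> t" by (simp_all add: past_def)
  obtain s where s: "s \<in> decay_times S V \<alpha> (flow f D (Sup past) x)" "0 < s" "s \<le> \<tau>"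
    using recurrent[OF decay_timesD(3)[OF m(1)]] by blast
  have "s + Sup past \<notin> past"
    using cSup_upper[OF _ bdd, of "s + Sup past"] s(2) by auto
  then have less: "t - Sup past < s"
    using decay_times_add[OF xD m(1) s(1)] by (auto simp: past_def)
  have "flow f D (Sup past) x \<in> D" using decay_timesD(3)[OF m(1)] S(2) by blast
  then have "t - Sup past \<in> existence_ivl f D (flow f D (Sup past) x)"
    using Icc_subset_existence_ivl[OF _ decay_timesD(2)[OF s(1)]] m(2) less by auto
  then show ?thesis
    using that[OF m] less s(3) by simp
qed

end

locale exponentially_recurrent_field = locally_lipschitz_field f D
  for f :: "real ^ 'n \<Rightarrow> real ^ 'n" and D +
  fixes N :: "real ^ 'n \<Rightarrow> real" and wp :: "real ^ 'n \<Rightarrow> real ^ 'n \<Rightarrow> real"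
    and S :: "(real ^ 'n) set" and xs :: "real ^ 'n" and V :: "real ^ 'n \<Rightarrow> real"
    and a1 a2 \<alpha> \<tau> :: real
  assumes norm: "is_norm N" and pairing: "associated_weak_pairing N wp"
    and equilibrium: "xs \<in> D" "f xs = 0"
    and compact_S: "compact S" and S_subset: "S \<subseteq> D" and xs_interior: "xs \<in> interior S"
    and ERLF: "ERLF N f D xs S V a1 a2 \<alpha> \<tau>"
begin

lemma ERLF_constants_pos: "0 < a1" "0 < a2" "0 < \<alpha>" "0 < \<tau>"
  using ERLF by (simp_all add: ERLF_def)

lemma V_bounds: "x \<in> D \<Longrightarrow> a1 * N (x - xs) \<le> V x" "x \<in> D \<Longrightarrow> V x \<le> a2 * N (x - xs)"
  using ERLF by (simp_all add: ERLF_def)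

lemma continuous_on_V: "continuous_on S V"
  using ERLF S_subset continuous_on_subset unfolding ERLF_def by blast

lemma xs_in_S: "xs \<in> S"
  using xs_interior interior_subset by blast

lemma recurrent:
  assumes "x \<in> S"
  shows "\<exists>s\<in>decay_times S V \<alpha> x. 0 < s \<and> s \<le> \<tau>"
proof (cases "x = xs")
  case True
  have "V xs = 0"
    using V_bounds[OF equilibrium(1)] is_normD(2)[OF norm, of 0] by simp
  then have "\<tau> \<in> decay_times S V \<alpha> x"
    using True flow_equilibrium[OF equilibrium, of \<tau>] xs_in_S ERLF_constants_pos
    by (simp add: decay_times_def)
  then show ?thesis using ERLF_constants_pos(4) by blast
next
  case False
  then obtain s where s: "s \<in> containment_times f D S x \<tau>" "exp (\<alpha> * s) * V (flow f D s x) \<le> V x"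
    using ERLF assms unfolding ERLF_def by blast
  then show ?thesis
    by (intro bexI[of _ s]) (auto simp: containment_times_def decay_times_def)
qed

lemmas decay_time_within_tau = decay_time_within[OF compact_S S_subset continuous_on_V recurrent]

lemma global_existence:
  assumes x: "x \<in> S" and t: "0 \<le> t"
  shows "t \<in> existence_ivl f D x"
proof -
  obtain m where "m \<in> decay_times S V \<alpha> x" "t - m \<in> existence_ivl f D (flow f D m x)"
    by (rule decay_time_within_tau[OF _ x t])
  then show ?thesis
    using flow_add(1)[of x m "t - m"] decay_timesD(2) x S_subset by auto
qed

abbreviation tube :: "(real ^ 'n) set" where "tube \<equiv> reachable_tube f D \<tau> S"

abbreviation L :: real where "L \<equiv> one_sided_lipschitz_const N wp f tube"

lemma compact_tube: "compact tube" and tube_subset: "tube \<subseteq> D"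
  using compact_reachable_tube[OF compact_S S_subset] global_existence ERLF_constants_pos(4)
  by simp_all

lemma flow_in_tube: "y \<in> S \<Longrightarrow> t \<in> {0..\<tau>} \<Longrightarrow> flow f D t y \<in> tube"
  unfolding reachable_tube_def using global_existence by fastforce

lemma S_subset_tube: "S \<subseteq> tube"
proof
  fix y assume "y \<in> S"
  then show "y \<in> tube"
    using flow_in_tube[of y 0] ERLF_constants_pos(4) S_subset by auto
qed

lemma ex_S_neq_xs: "\<exists>y\<in>S. y \<noteq> xs"
proof (rule ccontr)
  assume "\<not> (\<exists>y\<in>S. y \<noteq> xs)"
  then have "interior S \<subseteq> interior {xs}" by (intro interior_mono) blast
  then show False using xs_interior by simp
qed

lemma distance_bound_between_decay_times:
  assumes lip: "lipschitz_const_over N f tube M" and y: "y \<in> S" and r: "0 \<le> r" "r \<le> \<tau>"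
  shows "N (flow f D r y - xs) \<le> (1 + M * h_fun \<tau> L) * N (y - xs)"
proof -
  obtain b where b: "b \<in> S" "xs \<noteq> b" using ex_S_neq_xs by blast
  note one_sided = lipschitz_const_over_imp_one_sided[OF norm pairing lip]
  have L: "L \<le> M" "one_sided_lipschitz_over N wp f tube L"
    using one_sided_lipschitz_const_le[OF norm one_sided _ _ b(2)]
      one_sided_lipschitz_over_const[OF norm one_sided _ _ b(2)] b(1) xs_in_S S_subset_tube by blast+
  have yD: "y \<in> D" using y S_subset by blast
  have "N (flow f D r y - flow f D r xs) \<le> exp (L * r) * N (y - xs)"
  proof (rule norm_flow_diff_le_one_sided_exp[OF norm pairing r(1) yD global_existence[OF y r(1)]
        equilibrium(1) flow_equilibrium(1)[OF equilibrium]])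
    fix s assume "s \<in> {0..<r}"
    then have "flow f D s y \<in> tube" using flow_in_tube[OF y] r(2) by simp
    moreover have "xs \<in> tube" using xs_in_S S_subset_tube by blast
    ultimately show "wp (f (flow f D s y) - f (flow f D s xs)) (flow f D s y - flow f D s xs)
        \<le> L * (N (flow f D s y - flow f D s xs))\<^sup>2"
      using L(2) by (simp add: one_sided_lipschitz_over_def flow_equilibrium(2)[OF equilibrium])
  qed
  also have "\<dots> \<le> (1 + M * h_fun \<tau> L) * N (y - xs)"
    using lip L(1) r by (intro mult_right_mono exp_le_h_fun is_normD(1)[OF norm])
      (simp_all add: lipschitz_const_over_def)
  finally show ?thesis
    by (simp add: flow_equilibrium(2)[OF equilibrium])
qed

lemma distance_bound_at_decay_time:
  assumes x: "x \<in> D" and m: "m \<in> decay_times S V \<alpha> x"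
  shows "N (flow f D m x - xs) \<le> a2 / a1 * exp (- \<alpha> * m) * N (x - xs)"
proof -
  note m = decay_timesD[OF m]
  have "exp (\<alpha> * m) * (a1 * N (flow f D m x - xs)) \<le> exp (\<alpha> * m) * V (flow f D m x)"
    using V_bounds(1)[of "flow f D m x"] m(3) S_subset by auto
  also have "\<dots> \<le> a2 * N (x - xs)"
    using m(4) V_bounds(2)[OF x] by simp
  finally show ?thesis
    using ERLF_constants_pos(1) by (simp add: exp_minus field_simps)
qed

lemma exponential_bound:
  assumes lip: "lipschitz_const_over N f tube M" and x: "x \<in> S" and t: "0 \<le> t"
  shows "N (flow f D t x - xs) \<le> a2 / a1 * exp (\<alpha> * \<tau>)
    * (1 + M * h_fun \<tau> L) * exp (- \<alpha> * t) * N (x - xs)"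
    (is "_ \<le> a2 / a1 * _ * ?B * _ * _")
proof -
  have xD: "x \<in> D" using x S_subset by blast
  obtain m where m: "m \<in> decay_times S V \<alpha> x" "m \<le> t" "t - m \<le> \<tau>"
    "t - m \<in> existence_ivl f D (flow f D m x)"
    using decay_time_within_tau[OF _ x t] .
  have "0 \<le> h_fun \<tau> L"
    using ERLF_constants_pos(4) by (intro h_fun_nonneg) simp
  then have B_nonneg: "0 \<le> ?B"
    using lip by (simp add: lipschitz_const_over_def)
  have "N (flow f D t x - xs) = N (flow f D (t - m) (flow f D m x) - xs)"
    using flow_add(2)[OF xD decay_timesD(2)[OF m(1)] m(4)] by simp
  also have "\<dots> \<le> ?B * N (flow f D m x - xs)"
    using distance_bound_between_decay_times[OF lip decay_timesD(3)[OF m(1)]] m(2,3) by simp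
  also have "\<dots> \<le> ?B * (a2 / a1 * exp (- \<alpha> * m) * N (x - xs))"
    by (intro mult_left_mono distance_bound_at_decay_time xD m(1) B_nonneg)
  also have "\<dots> \<le> ?B * (a2 / a1 * (exp (\<alpha> * \<tau>) * exp (- \<alpha> * t)) * N (x - xs))"
  proof (intro mult_left_mono mult_right_mono)
    have "\<alpha> * (t - m) \<le> \<alpha> * \<tau>" using m(3) ERLF_constants_pos(3) by simp
    then show "exp (- \<alpha> * m) \<le> exp (\<alpha> * \<tau>) * exp (- \<alpha> * t)"
      by (simp add: algebra_simps flip: exp_add)
  qed (use B_nonneg ERLF_constants_pos is_normD(1)[OF norm] in simp_all)
  finally show ?thesis by (simp add: mult_ac)
qed

end

theorem theorem3:
  fixes N :: "real ^ 'n \<Rightarrow> real"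
    and wp :: "real ^ 'n \<Rightarrow> real ^ 'n \<Rightarrow> real"
    and f :: "real ^ 'n \<Rightarrow> real ^ 'n"
    and D S :: "(real ^ 'n) set"
    and xs :: "real ^ 'n"
    and V :: "real ^ 'n \<Rightarrow> real"
    and a1 a2 \<alpha> \<tau> :: real
  assumes "is_norm N"
    and "associated_weak_pairing N wp"
    and "open D"
    and "locally_lipschitz N D f"
    and "xs \<in> D" and "f xs = 0"
    and "compact S" and "S \<subseteq> D" and "xs \<in> interior S"
    and "ERLF N f D xs S V a1 a2 \<alpha> \<tau>"
  shows "let K = closure (reachable_tube f D \<tau> S);
             L = one_sided_lipschitz_const N wp f K
         in compact K \<and> K \<subseteq> D \<and>
            (\<forall>Lbar. lipschitz_const_over N f K Lbar \<longrightarrow>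
               (let C = a2 / a1 * exp (\<alpha> * \<tau>) * (1 + Lbar * h_fun \<tau> L)
                in \<forall>x\<in>S. \<forall>t\<ge>0. t \<in> existence_ivl f D x \<and>
                     N (flow f D t x - xs) \<le> C * exp (- \<alpha> * t) * N (x - xs)))"
proof -
  interpret locally_lipschitz_field f D
    using assms by (intro locally_lipschitz_imp_field)
  interpret exponentially_recurrent_field f D N wp S xs V a1 a2 \<alpha> \<tau>
    using assms by unfold_locales
  have "closure tube = tube"
    by (intro closure_closed compact_imp_closed compact_tube)
  then show ?thesis
    using compact_tube tube_subset global_existence exponential_bound by (simp add: Let_def)
qed

end
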